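(* For any $W\in\mathrm{Gr}^{\mathrm{ad}}$, $$\mathrm{Stab}_{G_y}(W)=\{(x+q'(y),\,y)\in G\;:\;q\in A_W\},$$ where $q'$ denotes the derivative of the polynomial $q$.
   Context: $G$ is the group of all $\mathbb{C}$-algebra automorphisms $\sigma=(\sigma(x),\sigma(y))$ of $\mathbb{C}\langle x,y\rangle$ with $\sigma([x,y])=[x,y]$, and $G_y=\{(x+p(y),y):p\in\mathbb{C}[y]\}\subset G$. A linear subspace $W\subseteq\mathbb{C}[z]$ is primary decomposable if there are finitely many points $\lambda_1,\dots,\lambda_N\in\mathbb{C}$ with $W=\bigcap_{i=1}^N W_{\lambda_i}$, where each $W_{\lambda_i}$ is a $\lambda_i$-primary subspace of $\mathbb{C}[z]$, i.e. one containing a power of the maximal ideal $\mathfrak{m}_{\lambda_i}=(z-\lambda_i)$. It is irreducible if it is not contained in a proper ideal of $\mathbb{C}[z]$. The adelic Grassmannian $\mathrm{Gr}^{\mathrm{ad}}$ is the set of primary decomposable subspaces modulo the equivalence $W\sim W'$ iff $pW=qW'$ for some (nonzero) polynomials $p,q$; each class contains a unique irreducible subspace, so $\mathrm{Gr}^{\mathrm{ad}}$ is identified with the set of irreducible primary decomposable subspaces of $\mathbb{C}[z]$. For $W\in\mathrm{Gr}^{\mathrm{ad}}$, $A_W=\{q\in\mathbb{C}[z]:qW\subseteq W\}$. Action of $G_y$ on $\mathrm{Gr}^{\mathrm{ad}}$: let $\mathcal{H}$ be the space of entire functions on $\mathbb{C}$ with the topology of uniform convergence on compact sets, and let $\overline{W}$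 denote the closure of $W$ in $\mathcal{H}$. For $q\in\mathbb{C}[z]$ put $e^q\cdot W=(e^q\,\overline{W})\cap\mathbb{C}[z]$. The element $(x+q'(y),y)\in G_y$ acts on $\mathrm{Gr}^{\mathrm{ad}}$ by $W\mapsto e^{q}\cdot W$ (replacing $e^q$ by $e^{-q}$ does not affect stabilizers). *)

theory Defs
  imports
    "HOL-Complex_Analysis.Complex_Analysis"
    "HOL-Computational_Algebra.Polynomial"
    "HOL-Library.Poly_Mapping"
begin

datatype letter = Lx | Ly

text \<open>The free monoid on two letters, written additively since the monoid algebra structure of
  \<open>'a \<Rightarrow>\<^sub>0 'b\<close> is based on an additive (not necessarily commutative) monoid of exponents.\<close>

datatype xy_word = Word (letters: "letter list")

instantiation xy_word :: monoid_add
begin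

definition zero_xy_word :: xy_word where "0 = Word []"

definition plus_xy_word :: "xy_word \<Rightarrow> xy_word \<Rightarrow> xy_word"
  where "v + w = Word (letters v @ letters w)"

instance
  by standard (simp_all add: zero_xy_word_def plus_xy_word_def)

end

type_synonym free_alg = "xy_word \<Rightarrow>\<^sub>0 complex"

definition gen_x :: free_alg where "gen_x = Poly_Mapping.single (Word [Lx]) 1"

definition gen_y :: free_alg where "gen_y = Poly_Mapping.single (Word [Ly]) 1"

definition scalar :: "complex \<Rightarrow> free_alg" where "scalar c = Poly_Mapping.single 0 c"

definition commutator :: "free_alg \<Rightarrow> free_alg \<Rightarrow> free_alg"
  where "commutator a b = a * b - b * a"

definition alg_hom :: "(free_alg \<Rightarrow> free_alg) \<Rightarrow> bool"
  where "alg_hom \<sigma> \<longleftrightarrow>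
    \<sigma> 1 = 1 \<and>
    (\<forall>f g. \<sigma> (f + g) = \<sigma> f + \<sigma> g) \<and>
    (\<forall>f g. \<sigma> (f * g) = \<sigma> f * \<sigma> g) \<and>
    (\<forall>c f. \<sigma> (scalar c * f) = scalar c * \<sigma> f)"

definition autG :: "(free_alg \<Rightarrow> free_alg) set"
  where "autG = {\<sigma>. alg_hom \<sigma> \<and> bij \<sigma> \<and> \<sigma> (commutator gen_x gen_y) = commutator gen_x gen_y}"

text \<open>\<open>endo a b\<close> is the endomorphism written \<open>(a, b)\<close>: the substitution of \<open>a\<close> for \<open>x\<close> and of \<open>b\<close>
  for \<open>y\<close>.  By \<open>endo_unique\<close> below it is the only algebra endomorphism with these values on the
  generators.\<close>

definition endo :: "free_alg \<Rightarrow> free_alg \<Rightarrow> free_alg \<Rightarrow> free_alg"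
  where "endo a b f = (\<Sum>w\<in>Poly_Mapping.keys f. scalar (Poly_Mapping.lookup f w) *
           prod_list (map (\<lambda>l. case l of Lx \<Rightarrow> a | Ly \<Rightarrow> b) (letters w)))"

definition poly_at_y :: "complex poly \<Rightarrow> free_alg"
  where "poly_at_y p = (\<Sum>i\<le>Polynomial.degree p. scalar (coeff p i) * gen_y ^ i)"

definition autGy :: "(free_alg \<Rightarrow> free_alg) set"
  where "autGy = {endo (gen_x + poly_at_y p) gen_y | p. True}"


interpretation poly_vs: vector_space "smult :: complex \<Rightarrow> complex poly \<Rightarrow> complex poly"
  by unfold_locales (simp_all add: smult_add_left smult_add_right)

definition poly_ideal :: "complex poly set \<Rightarrow> bool"
  where "poly_ideal I \<longleftrightarrow> 0 \<in> I \<and> (\<forall>f\<in>I. \<forall>g\<in>I. f + g \<in> I) \<and> (\<forall>f\<in>I. \<forall>h. h * f \<in> I)"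

text \<open>The \<open>n\<close>-th power of the maximal ideal at \<open>\<mu>\<close> is the set of multiples of \<open>(z - \<mu>)^n\<close>.\<close>

definition primary_subspace :: "complex \<Rightarrow> complex poly set \<Rightarrow> bool"
  where "primary_subspace \<mu> W \<longleftrightarrow> poly_vs.subspace W \<and> (\<exists>n. {p. [:-\<mu>, 1:] ^ n dvd p} \<subseteq> W)"

definition primary_decomposable :: "complex poly set \<Rightarrow> bool"
  where "primary_decomposable W \<longleftrightarrow> poly_vs.subspace W \<and>
    (\<exists>M V. finite M \<and> (\<forall>\<mu>\<in>M. primary_subspace \<mu> (V \<mu>)) \<and> W = (\<Inter>\<mu>\<in>M. V \<mu>))"

definition irreducible_subspace :: "complex poly set \<Rightarrow> bool"
  where "irreducible_subspace W \<longleftrightarrow> \<not> (\<exists>I. poly_ideal I \<and> I \<noteq> UNIV \<and> W \<subseteq> I)"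

text \<open>Each class of primary decomposable subspaces modulo \<open>W \<sim> W' \<longleftrightarrow> (\<exists>p q. p \<noteq> 0 \<and> q \<noteq> 0 \<and> pW = qW')\<close>
  is represented by its unique irreducible member.\<close>

definition Gr_ad :: "complex poly set set"
  where "Gr_ad = {W. primary_decomposable W \<and> irreducible_subspace W}"

definition stabilizer_ring :: "complex poly set \<Rightarrow> complex poly set"
  where "stabilizer_ring W = {q. \<forall>w\<in>W. q * w \<in> W}"


definition entire :: "(complex \<Rightarrow> complex) set"
  where "entire = {f. f holomorphic_on UNIV}"

text \<open>The topology of uniform convergence on compact sets on the space of entire functions.\<close>

definition entire_topology :: "(complex \<Rightarrow> complex) topology"
  where "entire_topology = topology (\<lambda>U. U \<subseteq> entire \<and>
    (\<forall>f\<in>U. \<exists>K e. compact K \<and> e > 0 \<and> {g \<in> entire. \<forall>z\<in>K. dist (g z) (f z) < e} \<subseteq> U))"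

definition exp_act :: "complex poly \<Rightarrow> complex poly set \<Rightarrow> complex poly set"
  where "exp_act q W =
    {w. poly w \<in> (\<lambda>f z. exp (poly q z) * f z) ` (entire_topology closure_of (poly ` W))}"

text \<open>An element of \<open>autGy\<close> determines \<open>q\<close> only up to an additive constant, which changes \<open>exp q\<close> by a
  nonzero scalar; see \<open>Gy_act_eq\<close> below.\<close>

definition Gy_act :: "(free_alg \<Rightarrow> free_alg) \<Rightarrow> complex poly set \<Rightarrow> complex poly set"
  where "Gy_act \<sigma> W =
    (THE V. \<exists>q. \<sigma> = endo (gen_x + poly_at_y (pderiv q)) gen_y \<and> V = exp_act q W)"

definition stab_Gy :: "complex poly set \<Rightarrow> (free_alg \<Rightarrow> free_alg) set"
  where "stab_Gy W = {\<sigma> \<in> autGy. Gy_act \<sigma> W = W}"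


lemma scalar_simps:
  "scalar 0 = 0" "scalar 1 = 1" "scalar (c + d) = scalar c + scalar d"
  "scalar (c * d) = scalar c * scalar d" "scalar (- c) = - scalar c"
  by (simp_all add: scalar_def single_add mult_single single_uminus)

lemma lookup_scalar_mult:
  "Poly_Mapping.lookup (scalar c * f) w = c * Poly_Mapping.lookup f w"
  unfolding scalar_def mult_map_scale_conv_mult[symmetric]
  by (simp add: Poly_Mapping.map.rep_eq when_def)

lemma free_alg_induct [case_names zero add]:
  fixes f :: free_alg
  assumes "P 0" "\<And>w c f. P f \<Longrightarrow> P (Poly_Mapping.single w c + f)"
  shows "P f"
proof (induction f rule: Poly_Mapping.update_induct)
  case const
  then show ?case by (fact assms(1))
next
  case (update f a b)
  have "Poly_Mapping.update a b f = Poly_Mapping.single a b + f"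
    using update(1)
    by (intro poly_mapping_eqI) (auto simp: lookup_update lookup_add lookup_single when_def in_keys_iff)
  with update assms(2) show ?case by simp
qed

lemma scalar_commute: "scalar c * f = f * scalar c"
  by (induction f rule: free_alg_induct)
     (simp_all add: distrib_left distrib_right scalar_def mult_single mult.commute)

context
  fixes a b :: free_alg
begin

definition word_val :: "xy_word \<Rightarrow> free_alg"
  where "word_val w = prod_list (map (\<lambda>l. case l of Lx \<Rightarrow> a | Ly \<Rightarrow> b) (letters w))"

lemma word_val_add: "word_val (v + w) = word_val v * word_val w"
  by (simp add: word_val_def plus_xy_word_def)

lemma endo_alt:
  assumes "finite S" "Poly_Mapping.keys f \<subseteq> S"
  shows "endo a b f = (\<Sum>w\<in>S. scalar (Poly_Mapping.lookup f w) * word_val w)"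
  unfolding endo_def word_val_def
  using assms by (intro sum.mono_neutral_left) (auto simp: in_keys_iff scalar_simps)

lemma endo_add: "endo a b (f + g) = endo a b f + endo a b g"
proof -
  let ?S = "Poly_Mapping.keys f \<union> Poly_Mapping.keys g"
  have "Poly_Mapping.keys (f + g) \<subseteq> ?S" by (rule keys_add)
  then show ?thesis
    by (simp add: endo_alt[of ?S] lookup_add scalar_simps distrib_right sum.distrib)
qed

lemma endo_single: "endo a b (Poly_Mapping.single w c) = scalar c * word_val w"
  by (simp add: endo_alt[of "{w}"])

lemma endo_0: "endo a b 0 = 0"
  by (simp add: endo_def)

lemma endo_mult: "endo a b (f * g) = endo a b f * endo a b g"
proof (induction f rule: free_alg_induct)
  case zero
  then show ?case by (simp add: endo_0)
next
  case (add w c f)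
  have "endo a b (Poly_Mapping.single w c * g) = scalar c * word_val w * endo a b g"
  proof (induction g rule: free_alg_induct)
    case zero
    then show ?case by (simp add: endo_0)
  next
    case (add v d g)
    have "scalar c * word_val w * (scalar d * word_val v)
        = scalar c * scalar d * (word_val w * word_val v)"
      by (metis mult.assoc scalar_commute)
    then show ?case using add
      by (simp add: distrib_left endo_add mult_single endo_single scalar_simps word_val_add)
  qed
  with add show ?case
    by (simp add: distrib_right endo_add endo_single)
qed

lemma alg_hom_endo: "alg_hom (endo a b)"
proof -
  have "endo a b 1 = 1"
    using endo_single[of 0 1]
    by (simp add: scalar_simps word_val_def) (simp add: zero_xy_word_def)
  moreover have "endo a b (scalar c * f) = scalar c * endo a b f" for c f
    by (simp add: endo_mult)
       (simp add: scalar_def[of c] endo_single word_val_def zero_xy_word_def)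
  ultimately show ?thesis
    by (simp add: alg_hom_def endo_add endo_mult)
qed

lemma endo_gen: "endo a b gen_x = a" "endo a b gen_y = b"
  by (simp_all add: gen_x_def gen_y_def endo_single scalar_simps word_val_def)

end

lemma alg_homD:
  assumes "alg_hom \<sigma>"
  shows "\<sigma> 1 = 1" "\<sigma> (f + g) = \<sigma> f + \<sigma> g" "\<sigma> (f * g) = \<sigma> f * \<sigma> g"
    "\<sigma> (scalar c * f) = scalar c * \<sigma> f" "\<sigma> 0 = 0"
proof -
  show add: "\<sigma> (f + g) = \<sigma> f + \<sigma> g" for f g
    using assms unfolding alg_hom_def by blast
  show "\<sigma> 0 = 0" using add[of 0 0] by simp
qed (use assms in \<open>unfold alg_hom_def, blast+\<close>)

lemma alg_hom_comp:
  assumes "alg_hom \<sigma>" "alg_hom \<tau>"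
  shows "alg_hom (\<lambda>f. \<sigma> (\<tau> f))"
  using assms unfolding alg_hom_def by (intro conjI allI; metis)

lemma alg_hom_eqI:
  assumes "alg_hom \<sigma>" "alg_hom \<tau>" "\<sigma> gen_x = \<tau> gen_x" "\<sigma> gen_y = \<tau> gen_y"
  shows "\<sigma> = \<tau>"
proof
  note hom = alg_homD[OF assms(1)] alg_homD[OF assms(2)]
  have word: "\<sigma> (Poly_Mapping.single (Word ls) 1) = \<tau> (Poly_Mapping.single (Word ls) 1)" for ls
  proof (induction ls)
    case Nil
    have "Poly_Mapping.single (Word []) (1::complex) = 1"
      by (simp flip: zero_xy_word_def)
    then show ?case using hom by simp
  next
    case (Cons l ls)
    have "Poly_Mapping.single (Word (l # ls)) (1::complex)
        = (case l of Lx \<Rightarrow> gen_x | Ly \<Rightarrow> gen_y) * Poly_Mapping.single (Word ls) 1"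
      by (cases l) (simp_all add: gen_x_def gen_y_def mult_single plus_xy_word_def)
    then show ?case using Cons assms(3,4) by (cases l) (simp_all add: hom)
  qed
  have "\<sigma> (Poly_Mapping.single w c) = \<tau> (Poly_Mapping.single w c)" for w c
  proof -
    have "Poly_Mapping.single w c = scalar c * Poly_Mapping.single (Word (letters w)) 1"
      by (simp add: scalar_def mult_single)
    then show ?thesis by (simp only: hom(4,9) word)
  qed
  then show "\<sigma> f = \<tau> f" for f
    by (induction f rule: free_alg_induct) (simp_all add: hom)
qed

lemma endo_unique:
  assumes "alg_hom \<sigma>"
  shows "\<sigma> = endo (\<sigma> gen_x) (\<sigma> gen_y)"
  by (rule alg_hom_eqI) (simp_all add: assms alg_hom_endo endo_gen)

lemma gen_y_power: "gen_y ^ n = Poly_Mapping.single (Word (replicate n Ly)) 1"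
proof (induction n)
  case 0
  then show ?case by (simp flip: zero_xy_word_def)
next
  case (Suc n)
  then show ?case by (simp add: gen_y_def mult_single plus_xy_word_def)
qed

lemma lookup_poly_at_y:
  "Poly_Mapping.lookup (poly_at_y p) (Word (replicate n Ly)) = coeff p n"
proof -
  have "Poly_Mapping.lookup (poly_at_y p) (Word (replicate n Ly))
      = (\<Sum>i\<le>Polynomial.degree p. coeff p i * (if i = n then 1 else 0))"
    unfolding poly_at_y_def lookup_sum lookup_scalar_mult gen_y_power
    by (intro sum.cong refl) (auto simp: lookup_single when_def)
  also have "\<dots> = coeff p n"
    by (simp add: if_distrib coeff_eq_0 cong: if_cong)
  finally show ?thesis .
qed

lemma poly_at_y_inj: "poly_at_y p = poly_at_y p' \<Longrightarrow> p = p'"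
  by (metis lookup_poly_at_y poly_eqI)

lemma poly_at_y_uminus: "poly_at_y (- p) = - poly_at_y p"
  by (simp add: poly_at_y_def scalar_simps sum_negf)

lemma alg_hom_poly_at_y:
  assumes "alg_hom \<sigma>" "\<sigma> gen_y = gen_y"
  shows "\<sigma> (poly_at_y p) = poly_at_y p"
proof -
  note hom = alg_homD[OF assms(1)]
  have pow: "\<sigma> (gen_y ^ n) = gen_y ^ n" for n
    by (induction n) (simp_all add: hom assms(2))
  have "\<sigma> (sum h S) = (\<Sum>i\<in>S. \<sigma> (h i))" if "finite S" for h and S :: "nat set"
    using that by (induction S) (simp_all add: hom)
  then show ?thesis
    by (simp add: poly_at_y_def hom(4) pow)
qed

lemma autGy_subset_autG: "autGy \<subseteq> autG"
proof
  fix \<sigma> assume "\<sigma> \<in> autGy"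
  then obtain p where \<sigma>: "\<sigma> = endo (gen_x + poly_at_y p) gen_y"
    by (auto simp: autGy_def)
  have inverse: "endo (gen_x + poly_at_y r) gen_y (endo (gen_x + poly_at_y (- r)) gen_y f) = f"
    for r f
  proof -
    let ?s = "endo (gen_x + poly_at_y r) gen_y" and ?t = "endo (gen_x + poly_at_y (- r)) gen_y"
    have hom: "alg_hom ?s" "alg_hom ?t" by (rule alg_hom_endo)+
    then have "alg_hom (\<lambda>f. ?s (?t f))" by (rule alg_hom_comp)
    moreover have "alg_hom (\<lambda>f. f)" by (simp add: alg_hom_def)
    moreover have "?s (?t gen_x) = gen_x"
    proof -
      have "?s (gen_x + poly_at_y (- r)) = ?s gen_x + ?s (poly_at_y (- r))"
        by (rule alg_homD(2)[OF hom(1)])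
      then show ?thesis
        by (simp only: endo_gen alg_hom_poly_at_y[OF hom(1) endo_gen(2)])
           (simp add: poly_at_y_uminus)
    qed
    moreover have "?s (?t gen_y) = gen_y" by (simp add: endo_gen)
    ultimately have "(\<lambda>f. ?s (?t f)) = (\<lambda>f. f)" by (rule alg_hom_eqI)
    then show ?thesis by metis
  qed
  have "bij \<sigma>"
    by (rule o_bij[of "endo (gen_x + poly_at_y (- p)) gen_y"])
       (use inverse[of p] inverse[of "- p"] in \<open>auto simp: \<sigma> fun_eq_iff\<close>)
  have hom: "alg_hom \<sigma>" by (simp add: \<sigma> alg_hom_endo)
  have comm: "poly_at_y p * gen_y = gen_y * poly_at_y p"
    unfolding poly_at_y_def sum_distrib_left sum_distrib_right
    by (intro sum.cong refl) (metis mult.assoc power_commutes scalar_commute)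
  have minus: "\<sigma> (f - g) = \<sigma> f - \<sigma> g" for f g
    using alg_homD(2)[OF hom, of "f - g" g] by simp
  have "\<sigma> (commutator gen_x gen_y) = commutator (\<sigma> gen_x) (\<sigma> gen_y)"
    by (simp add: commutator_def minus alg_homD(3)[OF hom])
  also have "\<dots> = commutator gen_x gen_y"
    by (simp add: \<sigma> endo_gen commutator_def distrib_left distrib_right comm)
  finally show "\<sigma> \<in> autG"
    using hom \<open>bij \<sigma>\<close> by (simp add: autG_def)
qed

lemma openin_entire_topology:
  "openin entire_topology U \<longleftrightarrow> U \<subseteq> entire \<and>
    (\<forall>f\<in>U. \<exists>K e. compact K \<and> e > 0 \<and> {g \<in> entire. \<forall>z\<in>K. dist (g z) (f z) < e} \<subseteq> U)"
proof -
  define L where "L U \<longleftrightarrow> U \<subseteq> entire \<and>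
    (\<forall>f\<in>U. \<exists>K e. compact K \<and> e > (0::real) \<and> {g \<in> entire. \<forall>z\<in>K. dist (g z) (f z) < e} \<subseteq> U)" for U
  have "L (S \<inter> T)" if S: "L S" and T: "L T" for S T
    unfolding L_def
  proof (intro conjI ballI)
    note S = S[unfolded L_def] and T = T[unfolded L_def]
    show "S \<inter> T \<subseteq> entire" using S by blast
    fix f assume f: "f \<in> S \<inter> T"
    obtain K d where K: "compact K" "d > 0" "{g \<in> entire. \<forall>z\<in>K. dist (g z) (f z) < d} \<subseteq> S"
      using S f by blast
    obtain L e where L: "compact L" "e > 0" "{g \<in> entire. \<forall>z\<in>L. dist (g z) (f z) < e} \<subseteq> T"
      using T f by blast
    have "{g \<in> entire. \<forall>z\<in>K \<union> L. dist (g z) (f z) < min d e} \<subseteq> S \<inter> T"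
      using K(3) L(3) by auto
    then show "\<exists>K e. compact K \<and> e > 0 \<and> {g \<in> entire. \<forall>z\<in>K. dist (g z) (f z) < e} \<subseteq> S \<inter> T"
      using K L by (intro exI[of _ "K \<union> L"] exI[of _ "min d e"]) (simp add: compact_Un)
  qed
  moreover have "L (\<Union>\<K>)" if all: "\<forall>S\<in>\<K>. L S" for \<K>
    unfolding L_def
  proof (intro conjI ballI)
    show "\<Union>\<K> \<subseteq> entire" using all unfolding L_def by blast
    fix f assume "f \<in> \<Union>\<K>"
    then obtain S where S: "S \<in> \<K>" "f \<in> S" by blast
    then obtain K e where "compact K" "e > 0" "{g \<in> entire. \<forall>z\<in>K. dist (g z) (f z) < e} \<subseteq> S"
      using all[rule_format, OF S(1), unfolded L_def] by blast
    with S(1) show "\<exists>K e. compact K \<and> e > 0 \<and> {g \<in> entire. \<forall>z\<in>K. dist (g z) (f z) < e} \<subseteq> \<Union>\<K>"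
      by blast
  qed
  ultimately have "istopology L" unfolding istopology_def by blast
  then have "openin (topology L) = L" by (rule topology_inverse')
  then show ?thesis by (simp only: entire_topology_def L_def[abs_def])
qed

lemma topspace_entire_topology: "topspace entire_topology = entire"
proof
  show "topspace entire_topology \<subseteq> entire"
    using openin_topspace openin_entire_topology by blast
  have "openin entire_topology entire"
    unfolding openin_entire_topology by (auto intro!: exI[of _ "{}"] exI[of _ 1])
  then show "entire \<subseteq> topspace entire_topology" by (rule openin_subset)
qed

lemma in_closure_of_entire_topology:
  assumes "S \<subseteq> entire"
  shows "f \<in> entire_topology closure_of S \<longleftrightarrow>
    f \<in> entire \<and> (\<forall>K e. compact K \<longrightarrow> e > 0 \<longrightarrow> (\<exists>g\<in>S. \<forall>z\<in>K. dist (g z) (f z) < e))"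
proof (intro iffI conjI allI impI)
  assume f: "f \<in> entire_topology closure_of S"
  then show "f \<in> entire"
    by (simp add: in_closure_of topspace_entire_topology)
  fix K :: "complex set" and e :: real
  assume K: "compact K" "e > 0"
  let ?U = "{g \<in> entire. \<exists>d<e. \<forall>z\<in>K. dist (g z) (f z) \<le> d}"
  have "openin entire_topology ?U"
    unfolding openin_entire_topology
  proof (intro conjI ballI)
    fix g assume "g \<in> ?U"
    then obtain d where d: "d < e" "\<forall>z\<in>K. dist (g z) (f z) \<le> d" by blast
    have "h \<in> ?U" if h: "h \<in> entire" "\<forall>z\<in>K. dist (h z) (g z) < (e - d) / 2" for h
    proof -
      have "dist (h z) (f z) \<le> (e + d) / 2" if "z \<in> K" for z
        using h(2)[rule_format, OF that] d(2)[rule_format, OF that]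
          dist_triangle[of "h z" "f z" "g z"] by argo
      moreover have "(e + d) / 2 < e" using d(1) by simp
      ultimately show ?thesis using h(1) by blast
    qed
    then show "\<exists>K e. compact K \<and> e > 0 \<and> {h \<in> entire. \<forall>z\<in>K. dist (h z) (g z) < e} \<subseteq> ?U"
      using K(1) d(1) by (intro exI[of _ K] exI[of _ "(e - d) / 2"]) auto
  qed auto
  moreover have "f \<in> ?U" using \<open>f \<in> entire\<close> K(2) by auto
  ultimately obtain g where "g \<in> S" "g \<in> ?U"
    using f[unfolded in_closure_of, THEN conjunct2, rule_format, of ?U] by blast
  then obtain d where "d < e" "\<forall>z\<in>K. dist (g z) (f z) \<le> d" by blast
  then have "\<forall>z\<in>K. dist (g z) (f z) < e" by (meson le_less_trans)
  then show "\<exists>g\<in>S. \<forall>z\<in>K. dist (g z) (f z) < e" using \<open>g \<in> S\<close> by (rule bexI)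
next
  assume R: "f \<in> entire \<and>
    (\<forall>K e. compact K \<longrightarrow> e > 0 \<longrightarrow> (\<exists>g\<in>S. \<forall>z\<in>K. dist (g z) (f z) < e))"
  show "f \<in> entire_topology closure_of S"
    unfolding in_closure_of topspace_entire_topology
  proof (intro conjI allI impI)
    show "f \<in> entire" using R by blast
    fix T assume T: "f \<in> T \<and> openin entire_topology T"
    obtain K e where K: "compact K" "e > 0" "{g \<in> entire. \<forall>z\<in>K. dist (g z) (f z) < e} \<subseteq> T"
      using T[THEN conjunct2, unfolded openin_entire_topology, THEN conjunct2, rule_format, of f] T
      by blast
    obtain g where "g \<in> S" "\<forall>z\<in>K. dist (g z) (f z) < e"
      using R K(1,2) by blast
    with K(3) assms show "\<exists>g. g \<in> S \<and> g \<in> T" by blast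
  qed
qed

lemma poly_image_subset_entire: "poly ` W \<subseteq> entire"
  by (auto simp: entire_def intro!: holomorphic_intros)

lemma closure_scale:
  assumes "poly_vs.subspace W" "f \<in> entire_topology closure_of (poly ` W)"
  shows "(\<lambda>z. c * f z) \<in> entire_topology closure_of (poly ` W)"
  unfolding in_closure_of_entire_topology[OF poly_image_subset_entire]
proof (intro conjI allI impI)
  note f = assms(2)[unfolded in_closure_of_entire_topology[OF poly_image_subset_entire]]
  show "(\<lambda>z. c * f z) \<in> entire"
    using f by (auto simp: entire_def intro!: holomorphic_intros)
  fix K :: "complex set" and e :: real
  assume K: "compact K" "e > 0"
  have pos: "e / (norm c + 1) > 0"
    using K(2) norm_ge_zero[of c] by (intro divide_pos_pos) linarith+
  then obtain w where w: "w \<in> W" "\<forall>z\<in>K. dist (poly w z) (f z) < e / (norm c + 1)"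
    using f K(1) by blast
  have "dist (poly (smult c w) z) (c * f z) < e" if "z \<in> K" for z
  proof -
    have "dist (poly (smult c w) z) (c * f z) = norm c * dist (poly w z) (f z)"
      by (simp add: dist_norm norm_mult flip: right_diff_distrib)
    also have "\<dots> \<le> norm c * (e / (norm c + 1))"
      using w(2) that by (intro mult_left_mono) force+
    also have "\<dots> < (norm c + 1) * (e / (norm c + 1))"
      using pos by (intro mult_strict_right_mono) auto
    also have "\<dots> = e"
      using norm_ge_zero[of c] by (simp add: field_simps add_nonneg_eq_0_iff)
    finally show ?thesis .
  qed
  moreover have "smult c w \<in> W"
    using assms(1) w(1) by (rule poly_vs.subspace_scale)
  ultimately show "\<exists>g\<in>poly ` W. \<forall>z\<in>K. dist (g z) (c * f z) < e"
    by blast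
qed

lemma exp_act_add_const:
  assumes "poly_vs.subspace W"
  shows "exp_act (q + [:c:]) W = exp_act q W"
proof -
  have sub: "exp_act (q + [:c:]) W \<subseteq> exp_act q W" for q c
  proof
    fix w assume "w \<in> exp_act (q + [:c:]) W"
    then obtain f where f: "f \<in> entire_topology closure_of (poly ` W)"
        "poly w = (\<lambda>z. exp (poly (q + [:c:]) z) * f z)"
      unfolding exp_act_def mem_Collect_eq by (rule imageE)
    have "poly w = (\<lambda>z. exp (poly q z) * (exp c * f z))"
      unfolding f(2) by (simp add: exp_add mult.assoc)
    then show "w \<in> exp_act q W"
      unfolding exp_act_def mem_Collect_eq
      using closure_scale[OF assms f(1), of "exp c"] by (rule image_eqI)
  qed
  from sub[of q c] sub[of "q + [:c:]" "- c"] show ?thesis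
    by (simp add: add.assoc subset_antisym)
qed

lemma Gy_act_eq:
  assumes "poly_vs.subspace W"
  shows "Gy_act (endo (gen_x + poly_at_y (pderiv q)) gen_y) W = exp_act q W"
  unfolding Gy_act_def
proof (rule the_equality)
  fix V
  assume "\<exists>r. endo (gen_x + poly_at_y (pderiv q)) gen_y = endo (gen_x + poly_at_y (pderiv r)) gen_y
    \<and> V = exp_act r W"
  then obtain r where r: "V = exp_act r W"
    and eq: "endo (gen_x + poly_at_y (pderiv q)) gen_y = endo (gen_x + poly_at_y (pderiv r)) gen_y"
    by blast
  have "pderiv q = pderiv r"
    using fun_cong[OF eq, of gen_x] by (simp add: endo_gen) (rule poly_at_y_inj)
  then have "pderiv (r - q) = 0" by (simp add: pderiv_diff)
  then have "Polynomial.degree (r - q) = 0" by (simp add: pderiv_eq_0_iff)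
  then obtain c where "r - q = [:c:]" by (rule degree_eq_zeroE)
  then have "r = q + [:c:]" by (metis add.commute diff_add_cancel)
  then show "V = exp_act q W" using r assms exp_act_add_const by simp
qed blast

end

theory Submission
  imports Defs
begin

text \<open>
  An automorphism \<open>(x + q'(y), y)\<close> acts on \<open>W\<close> by \<open>exp q\<close>, so the claim is that
  \<open>exp q \<cdot> closure W\<close> meets the polynomials exactly in \<open>W\<close> if and only if \<open>q W \<subseteq> W\<close>
  (\<open>exp_act_fixes_iff\<close>).

  Everything is tested against linear functionals on polynomials that vanish on a power of a maximal
  ideal, that is, combinations of derivatives at one point \<open>\<mu>\<close>.  By the maximum principle they
  are continuous for uniform convergence on a disc around \<open>\<mu>\<close> (\<open>bounded_functional_at\<close>).
  A primary subspace is cut out by the functionals at its point that annihilate it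
  (\<open>separating_functional\<close>), hence the closure of a primary decomposable \<open>W\<close> contains
  no polynomials other than those of \<open>W\<close> (\<open>polynomials_in_closure\<close>).

  If \<open>q W \<subseteq> W\<close>, the exponential series shows that \<open>closure W\<close> is stable under multiplication by
  \<open>exp q\<close> and \<open>exp (- q)\<close>, so \<open>exp q\<close> fixes it, and also \<open>W\<close>.

  Conversely let \<open>exp q\<close> fix \<open>W\<close>.  Then \<open>exp (- k q) w\<close> lies in \<open>closure W\<close> for all \<open>w \<in> W\<close> and
  all natural \<open>k\<close>.  Let \<open>\<phi>\<close> be a functional at \<open>\<mu>\<close> annihilating the \<open>\<mu>\<close>-primary component, and
  put \<open>x = q - q(\<mu>)\<close>.  As \<open>x\<close> vanishes at \<open>\<mu>\<close>, only finitely many \<open>\<phi> (x ^ j w)\<close> are nonzero, and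
  \<open>\<phi>\<close> of \<open>exp (t x) w\<close> is the polynomial \<open>\<Sum>j. t ^ j / j! \<cdot> \<phi> (x ^ j w)\<close> in \<open>t\<close>.  It vanishes
  at \<open>t = 0, -1, -2, \<dots>\<close>, so it is zero; its linear coefficient gives \<open>\<phi> (x w) = 0\<close> and
  hence \<open>\<phi> (q w) = 0\<close>.  Letting \<open>\<phi>\<close> and \<open>\<mu>\<close> vary, \<open>q w \<in> W\<close>.  It is essential here that each
  \<open>\<phi>\<close> lives at a single point: the non-primary condition \<open>w(0) = w(1)\<close> is preserved by \<open>exp q\<close> for
  \<open>q = 2 \<pi> \<i> z\<close>, but not by \<open>q\<close>.
\<close>

section \<open>Functionals supported at a point\<close>

text \<open>These are the linear combinations of the functionals \<open>p \<mapsto> p^(k)(\<mu>)\<close> with \<open>k < n\<close>.\<close>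

definition functional_at :: "complex \<Rightarrow> nat \<Rightarrow> (complex poly \<Rightarrow> complex) \<Rightarrow> bool"
  where "functional_at \<mu> n \<phi> \<longleftrightarrow>
    Vector_Spaces.linear smult (*) \<phi> \<and> (\<forall>p. [:-\<mu>, 1:] ^ n dvd p \<longrightarrow> \<phi> p = 0)"

lemma functional_at_simps:
  assumes "functional_at \<mu> n \<phi>"
  shows "\<phi> (p + r) = \<phi> p + \<phi> r" "\<phi> (p - r) = \<phi> p - \<phi> r" "\<phi> (smult c p) = c * \<phi> p"
    "\<phi> 0 = 0" "\<phi> (sum g A) = (\<Sum>a\<in>A. \<phi> (g a))"
proof -
  interpret Vector_Spaces.linear smult "(*)" \<phi>
    using assms by (simp add: functional_at_def)
  show "\<phi> (p + r) = \<phi> p + \<phi> r" "\<phi> (p - r) = \<phi> p - \<phi> r" "\<phi> (smult c p) = c * \<phi> p"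
    "\<phi> 0 = 0" "\<phi> (sum g A) = (\<Sum>a\<in>A. \<phi> (g a))"
    by (simp_all add: add diff scale sum)
qed

text \<open>By induction on the order \<open>n\<close>: writing \<open>p = p(\<mu>) + (z - \<mu>) r\<close>, the functional
  \<open>r \<mapsto> \<phi> ((z - \<mu>) r)\<close> has smaller order, and since \<open>z - \<mu>\<close> has modulus 1 on the boundary of
  the unit disc, the maximum principle bounds \<open>r\<close> on the disc by twice the bound for \<open>p\<close>.\<close>

lemma bounded_functional_at:
  assumes "functional_at \<mu> n \<phi>"
  obtains C where "C \<ge> 0"
    "\<And>p B. (\<And>z. z \<in> cball \<mu> 1 \<Longrightarrow> norm (poly p z) \<le> B) \<Longrightarrow> norm (\<phi> p) \<le> C * B"
proof -
  have "\<exists>C\<ge>0. \<forall>p B. (\<forall>z\<in>cball \<mu> 1. norm (poly p z) \<le> B) \<longrightarrow> norm (\<phi> p) \<le> C * B"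
    using assms
  proof (induction n arbitrary: \<phi>)
    case 0
    then have "\<phi> p = 0" for p by (simp add: functional_at_def)
    then show ?case by auto
  next
    case (Suc n)
    note \<phi> = functional_at_simps[OF Suc.prems]
    define \<psi> where "\<psi> r = \<phi> ([:-\<mu>, 1:] * r)" for r
    have "functional_at \<mu> n \<psi>"
      unfolding functional_at_def
    proof (intro conjI allI impI)
      have "\<psi> (p + r) = \<psi> p + \<psi> r" "\<psi> (smult c p) = c * \<psi> p" for p r c
        by (simp_all only: \<psi>_def mult_smult_right distrib_left \<phi>)
      then show "Vector_Spaces.linear smult (*) \<psi>"
        by unfold_locales (simp_all add: algebra_simps)
    next
      fix p assume "[:-\<mu>, 1:] ^ n dvd p"
      then have "[:-\<mu>, 1:] ^ Suc n dvd [:-\<mu>, 1:] * p"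
        unfolding power_Suc by (rule mult_dvd_mono[OF dvd_refl])
      then show "\<psi> p = 0"
        using Suc.prems unfolding functional_at_def \<psi>_def by blast
    qed
    then obtain C where C: "C \<ge> 0"
      "\<And>p B. (\<forall>z\<in>cball \<mu> 1. norm (poly p z) \<le> B) \<Longrightarrow> norm (\<psi> p) \<le> C * B"
      using Suc.IH by blast
    have "norm (\<phi> p) \<le> (norm (\<phi> 1) + C * 2) * B"
      if B: "\<forall>z\<in>cball \<mu> 1. norm (poly p z) \<le> B" for p B
    proof -
      have "[:-\<mu>, 1:] dvd p - [:poly p \<mu>:]"
        by (simp flip: poly_eq_0_iff_dvd)
      then obtain r where r: "p - [:poly p \<mu>:] = [:-\<mu>, 1:] * r"
        by (auto elim: dvdE)
      have p: "p = smult (poly p \<mu>) 1 + [:-\<mu>, 1:] * r"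
        using r by (simp add: algebra_simps)
      have "norm (poly r z) \<le> 2 * B" if z: "z \<in> cball \<mu> 1" for z
      proof (rule maximum_modulus_frontier[of "poly r" "cball \<mu> 1"])
        fix y assume "y \<in> frontier (cball \<mu> 1)"
        then have y: "norm (y - \<mu>) = 1"
          by (simp add: dist_norm norm_minus_commute)
        have "norm (poly r y) = norm ((y - \<mu>) * poly r y)"
          by (simp add: norm_mult y)
        also have "(y - \<mu>) * poly r y = poly p y - poly p \<mu>"
          using arg_cong[OF r, of "\<lambda>s. poly s y"] by (simp add: algebra_simps)
        also have "norm \<dots> \<le> norm (poly p y) + norm (poly p \<mu>)"
          by (rule norm_triangle_ineq4)
        also have "\<dots> \<le> B + B"
          using y B by (intro add_mono) (auto simp: dist_norm norm_minus_commute)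
        finally show "norm (poly r y) \<le> 2 * B" by simp
      qed (use z in \<open>auto intro!: holomorphic_intros continuous_intros\<close>)
      then have "norm (\<psi> r) \<le> C * (2 * B)"
        by (intro C(2)) blast
      moreover have "norm (poly p \<mu> * \<phi> 1) \<le> B * norm (\<phi> 1)"
        unfolding norm_mult using B by (intro mult_right_mono) auto
      moreover have "\<phi> p = poly p \<mu> * \<phi> 1 + \<psi> r"
        by (subst p) (simp only: \<phi> \<psi>_def)
      ultimately show ?thesis
        using norm_triangle_ineq[of "poly p \<mu> * \<phi> 1" "\<psi> r"] by (simp add: algebra_simps)
    qed
    then show ?case
      using C(1) by (intro exI[of _ "norm (\<phi> 1) + C * 2"]) simp
  qed
  then show ?thesis using that by blast
qed

text \<open>Extend a basis of \<open>V\<close> by \<open>r\<close>, and send \<open>r\<close> to 1 and the basis of \<open>V\<close> to 0.\<close>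

lemma separating_functional:
  assumes "poly_vs.subspace V" "{p. [:-\<mu>, 1:] ^ n dvd p} \<subseteq> V" "r \<notin> V"
  obtains \<phi> where "functional_at \<mu> n \<phi>" "\<And>v. v \<in> V \<Longrightarrow> \<phi> v = 0" "\<phi> r = 1"
proof -
  interpret vector_space_pair "smult :: complex \<Rightarrow> complex poly \<Rightarrow> complex poly" "(*) :: complex \<Rightarrow> _"
    by unfold_locales (simp_all add: algebra_simps)
  obtain B where B: "B \<subseteq> V" "poly_vs.independent B" "V \<subseteq> poly_vs.span B"
    using poly_vs.maximal_independent_subset by blast
  have "poly_vs.span B \<subseteq> V"
    using assms(1) B(1) by (rule poly_vs.span_minimal[rotated])
  then have "r \<notin> poly_vs.span B"
    using assms(3) by blast
  then have "poly_vs.independent (insert r B)"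
    using B(2) by (rule poly_vs.independent_insertI)
  then obtain \<phi> where \<phi>: "Vector_Spaces.linear smult (*) \<phi>"
    "\<forall>b\<in>insert r B. \<phi> b = (if b = r then 1 else 0)"
    using linear_independent_extend[of "insert r B" "\<lambda>b. if b = r then 1 else 0"] by blast
  interpret \<phi>: Vector_Spaces.linear smult "(*)" \<phi> by (rule \<phi>(1))
  have zero: "\<phi> v = 0" if "v \<in> V" for v
  proof (rule \<phi>.eq_0_on_span[of B])
    show "v \<in> poly_vs.span B" using that B(3) by blast
    show "\<phi> b = 0" if "b \<in> B" for b
      using that \<phi>(2) B(1) assms(3) by auto
  qed
  show ?thesis
  proof (rule that[of \<phi>])
    show "functional_at \<mu> n \<phi>"
      using \<phi>(1) zero assms(2) unfolding functional_at_def by blast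
  qed (use zero \<phi>(2) in auto)
qed

section \<open>Closures of spaces of polynomials\<close>

abbreviation entire_closure :: "complex poly set \<Rightarrow> (complex \<Rightarrow> complex) set"
  where "entire_closure W \<equiv> entire_topology closure_of (poly ` W)"

lemma entire_closure_entire: "f \<in> entire_closure W \<Longrightarrow> f holomorphic_on UNIV"
  by (simp add: in_closure_of_entire_topology[OF poly_image_subset_entire] entire_def)

lemma entire_closure_approx:
  assumes "f \<in> entire_closure W" "compact K" "e > 0"
  obtains w where "w \<in> W" "\<And>z. z \<in> K \<Longrightarrow> dist (poly w z) (f z) < e"
proof -
  have "\<exists>g\<in>poly ` W. \<forall>z\<in>K. dist (g z) (f z) < e"
    using assms by (simp add: in_closure_of_entire_topology[OF poly_image_subset_entire])
  then show ?thesis using that by blast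
qed

lemma entire_closureI:
  assumes "f holomorphic_on UNIV"
    "\<And>K e. compact K \<Longrightarrow> e > 0 \<Longrightarrow> \<exists>w\<in>W. \<forall>z\<in>K. dist (poly w z) (f z) < e"
  shows "f \<in> entire_closure W"
  using assms by (simp add: in_closure_of_entire_topology[OF poly_image_subset_entire] entire_def)

lemma poly_in_entire_closure: "w \<in> W \<Longrightarrow> poly w \<in> entire_closure W"
  by (rule entire_closureI) (auto intro!: holomorphic_intros bexI[of _ w])

text \<open>Multiplication by \<open>g\<close> is continuous on entire functions, so it suffices to know where it sends
  a dense subset.\<close>

lemma entire_closure_mult:
  assumes g: "g holomorphic_on UNIV"
    and W: "\<And>w. w \<in> W \<Longrightarrow> (\<lambda>z. g z * poly w z) \<in> entire_closure W"
    and f: "f \<in> entire_closure W"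
  shows "(\<lambda>z. g z * f z) \<in> entire_closure W"
proof (rule entire_closureI)
  show "(\<lambda>z. g z * f z) holomorphic_on UNIV"
    using g entire_closure_entire[OF f] by (intro holomorphic_intros)
  fix K :: "complex set" and e :: real
  assume K: "compact K" "e > 0"
  have "compact (g ` K)"
    using K(1) g by (intro compact_continuous_image)
      (auto intro: continuous_on_subset holomorphic_on_imp_continuous_on)
  then obtain B where B: "B > 0" "\<And>z. z \<in> K \<Longrightarrow> norm (g z) \<le> B"
    using compact_imp_bounded[of "g ` K"] unfolding bounded_pos by blast
  obtain w where w: "w \<in> W" "\<And>z. z \<in> K \<Longrightarrow> dist (poly w z) (f z) < e / (2 * B)"
    using entire_closure_approx[OF f K(1), of "e / (2 * B)"] K(2) B(1) by auto
  obtain v where v: "v \<in> W" "\<And>z. z \<in> K \<Longrightarrow> dist (poly v z) (g z * poly w z) < e / 2"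
    using entire_closure_approx[OF W[OF w(1)] K(1), of "e / 2"] K(2) by auto
  have "dist (poly v z) (g z * f z) < e" if z: "z \<in> K" for z
  proof -
    have "dist (g z * poly w z) (g z * f z) = norm (g z) * dist (poly w z) (f z)"
      by (simp add: dist_norm norm_mult flip: right_diff_distrib)
    also have "\<dots> \<le> B * (e / (2 * B))"
      using B(1) B(2)[OF z] w(2)[OF z] by (intro mult_mono) auto
    also have "\<dots> = e / 2" using B(1) by simp
    finally show ?thesis
      using v(2)[OF z] dist_triangle[of "poly v z" "g z * f z" "g z * poly w z"] by linarith
  qed
  with v(1) show "\<exists>w\<in>W. \<forall>z\<in>K. dist (poly w z) (g z * f z) < e" by blast
qed

text \<open>Continuity of \<open>\<phi>\<close> on a function \<open>f\<close> in the closure, phrased without extending \<open>\<phi>\<close> to entire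
  functions: its would-be value at \<open>f\<close> is the limit along any polynomials tending to \<open>f\<close>, and
  this is the value 0 obtained along elements of \<open>W\<close>.\<close>

lemma functional_at_closure:
  assumes \<phi>: "functional_at \<mu> n \<phi>" and W: "\<And>w. w \<in> W \<Longrightarrow> \<phi> w = 0"
    and f: "f \<in> entire_closure W"
    and lim: "uniform_limit (cball \<mu> 1) (\<lambda>m. poly (P m)) f sequentially"
  shows "(\<lambda>m. \<phi> (P m)) \<longlonglongrightarrow> 0"
proof (rule tendstoI)
  fix e :: real assume e: "e > 0"
  obtain C where C: "C \<ge> 0"
    "\<And>p B. (\<And>z. z \<in> cball \<mu> 1 \<Longrightarrow> norm (poly p z) \<le> B) \<Longrightarrow> norm (\<phi> p) \<le> C * B"
    using bounded_functional_at[OF \<phi>] by blast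
  define d where "d = e / (2 * (C + 1))"
  have d: "d > 0" "C * (2 * d) < e"
    using e C(1) by (auto simp: d_def field_simps)
  obtain w where w: "w \<in> W" "\<And>z. z \<in> cball \<mu> 1 \<Longrightarrow> dist (poly w z) (f z) < d"
    using entire_closure_approx[OF f compact_cball d(1)] by blast
  show "eventually (\<lambda>m. dist (\<phi> (P m)) 0 < e) sequentially"
    using uniform_limitD[OF lim d(1)]
  proof eventually_elim
    case (elim m)
    have "norm (\<phi> (P m - w)) \<le> C * (2 * d)"
    proof (rule C(2))
      fix z assume z: "z \<in> cball \<mu> 1"
      show "norm (poly (P m - w) z) \<le> 2 * d"
        using elim[rule_format, OF z] w(2)[OF z] dist_triangle2[of "poly (P m) z" "poly w z" "f z"]
        by (simp add: dist_norm)
    qed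
    then show ?case
      using d(2) by (simp add: functional_at_simps[OF \<phi>] W[OF w(1)])
  qed
qed

text \<open>Otherwise a functional at some point would separate \<open>r\<close> from \<open>W\<close>, although continuity makes it
  vanish on the closure of \<open>W\<close>.\<close>

lemma polynomials_in_closure:
  assumes "primary_decomposable W" "poly r \<in> entire_closure W"
  shows "r \<in> W"
proof (rule ccontr)
  assume "r \<notin> W"
  then obtain \<mu> V where V: "W \<subseteq> V" "primary_subspace \<mu> V" "r \<notin> V"
    using assms(1) unfolding primary_decomposable_def by blast
  then obtain n \<phi> where \<phi>: "functional_at \<mu> n \<phi>" "\<And>v. v \<in> V \<Longrightarrow> \<phi> v = 0" "\<phi> r = 1"
    unfolding primary_subspace_def by (meson separating_functional)
  have "(\<lambda>m::nat. \<phi> r) \<longlonglongrightarrow> 0"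
    using \<phi>(1,2) V(1) assms(2)
    by (intro functional_at_closure[where f = "poly r" and W = W]) (auto intro!: uniform_limit_intros)
  then show False
    by (simp add: \<phi>(3) LIMSEQ_const_iff)
qed

section \<open>The exponential series\<close>

definition exp_partial :: "complex poly \<Rightarrow> nat \<Rightarrow> complex poly"
  where "exp_partial q m = (\<Sum>j<m. smult (1 / fact j) (q ^ j))"

lemma exp_partial_smult_mult:
  "exp_partial (smult t x) m * w = (\<Sum>j<m. smult (t ^ j / fact j) (x ^ j * w))"
  by (simp add: exp_partial_def sum_distrib_right smult_power)

lemma uniform_limit_exp_partial:
  assumes "compact K"
  shows "uniform_limit K (\<lambda>m. poly (exp_partial q m * w)) (\<lambda>z. exp (poly q z) * poly w z) sequentially"
proof -
  have bound: "\<exists>B>0. \<forall>z\<in>K. norm (poly p z) \<le> B" for p :: "complex poly"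
  proof -
    have "compact (poly p ` K)"
      using assms by (intro compact_continuous_image continuous_intros)
    then show ?thesis
      using compact_imp_bounded[of "poly p ` K"] unfolding bounded_pos by blast
  qed
  obtain A where A: "A > 0" "\<forall>z\<in>K. norm (poly q z) \<le> A" using bound by blast
  obtain B where B: "B > 0" "\<forall>z\<in>K. norm (poly w z) \<le> B" using bound by blast
  let ?f = "\<lambda>j z. poly q z ^ j /\<^sub>R fact j * poly w z"
  have "uniform_limit K (\<lambda>m z. \<Sum>j<m. ?f j z) (\<lambda>z. suminf (\<lambda>j. ?f j z)) sequentially"
  proof (rule Weierstrass_m_test)
    show "norm (?f j z) \<le> A ^ j /\<^sub>R fact j * B" if "z \<in> K" for j z
      using that A B unfolding norm_mult norm_scaleR norm_power real_scaleR_def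
      by (intro mult_mono power_mono) auto
    show "summable (\<lambda>j. A ^ j /\<^sub>R fact j * B)"
      by (intro summable_mult2 summable_exp_generic)
  qed
  moreover have "suminf (\<lambda>j. ?f j z) = exp (poly q z) * poly w z" for z
    unfolding exp_def by (rule suminf_mult2[symmetric, OF summable_exp_generic])
  moreover have "(\<Sum>j<m. ?f j z) = poly (exp_partial q m * w) z" for m z
    using exp_partial_smult_mult[of 1 q m w]
    by (simp add: poly_sum scaleR_conv_of_real divide_inverse_commute mult.assoc)
  ultimately show ?thesis by (simp only:)
qed

lemma exp_mult_in_closure:
  assumes sub: "poly_vs.subspace W" and q: "q \<in> stabilizer_ring W" and f: "f \<in> entire_closure W"
  shows "(\<lambda>z. exp (poly q z) * f z) \<in> entire_closure W"
proof (rule entire_closure_mult[OF _ _ f])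
  fix w assume w: "w \<in> W"
  have "q ^ j * w \<in> W" for j
    by (induction j) (use w q in \<open>auto simp: stabilizer_ring_def mult.assoc\<close>)
  then have partial: "exp_partial q m * w \<in> W" for m
    using sub unfolding exp_partial_def sum_distrib_right mult_smult_left
    by (intro poly_vs.subspace_sum poly_vs.subspace_scale)
  show "(\<lambda>z. exp (poly q z) * poly w z) \<in> entire_closure W"
  proof (rule entire_closureI)
    fix K :: "complex set" and e :: real
    assume "compact K" "e > 0"
    then have "eventually (\<lambda>m. \<forall>z\<in>K. dist (poly (exp_partial q m * w) z)
        (exp (poly q z) * poly w z) < e) sequentially"
      by (intro uniform_limitD uniform_limit_exp_partial)
    then show "\<exists>w'\<in>W. \<forall>z\<in>K. dist (poly w' z) (exp (poly q z) * poly w z) < e"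
      using partial eventually_happens'[OF sequentially_bot] by fast
  qed (intro holomorphic_intros)
qed (intro holomorphic_intros)

text \<open>The partial sums of \<open>\<phi> (exp (t x) w)\<close> stabilise at a polynomial \<open>S\<close> in \<open>t\<close>, because
  \<open>x ^ j\<close> has a zero of order at least \<open>j\<close> at \<open>\<mu>\<close>.  So \<open>S\<close> vanishes at every \<open>- k\<close>, and is zero.\<close>

lemma functional_at_mult_eq_0:
  assumes \<phi>: "functional_at \<mu> n \<phi>" and W: "\<And>w. w \<in> W \<Longrightarrow> \<phi> w = 0"
    and x: "poly x \<mu> = 0"
    and exp: "\<And>k::nat. (\<lambda>z. exp (- of_nat k * poly x z) * poly w z) \<in> entire_closure W"
  shows "\<phi> (x * w) = 0"
proof -
  define a where "a j = \<phi> (x ^ j * w) / fact j" for j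
  have "[:-\<mu>, 1:] dvd x"
    using x by (simp flip: poly_eq_0_iff_dvd)
  have a_0: "a j = 0" if "j \<ge> n" for j
  proof -
    have "[:-\<mu>, 1:] ^ n dvd [:-\<mu>, 1:] ^ j"
      using that by (rule le_imp_power_dvd)
    also have "[:-\<mu>, 1:] ^ j dvd x ^ j * w"
      using \<open>[:-\<mu>, 1:] dvd x\<close> by (intro dvd_mult2 dvd_power_same)
    finally show ?thesis
      using \<phi> by (simp add: functional_at_def a_def)
  qed
  \<comment> \<open>Two extra terms make sure that the linear coefficient is present even if \<open>n = 0\<close>.\<close>
  define S where "S = (\<Sum>j<n + 2. monom (a j) j)"
  have "poly S (- of_nat k) = 0" for k :: nat
  proof -
    let ?t = "- of_nat k :: complex"
    let ?P = "\<lambda>m. exp_partial (smult ?t x) m * w"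
    have "\<phi> (?P m) = poly S ?t" if m: "m \<ge> n + 2" for m
    proof -
      have "\<phi> (?P m) = (\<Sum>j<m. ?t ^ j * a j)"
        by (simp only: exp_partial_smult_mult functional_at_simps[OF \<phi>] a_def times_divide_eq_left
            times_divide_eq_right)
      also have "\<dots> = (\<Sum>j<n + 2. ?t ^ j * a j)"
        using m a_0 by (intro sum.mono_neutral_right) auto
      finally show ?thesis
        by (simp add: S_def poly_sum poly_monom mult.commute)
    qed
    then have "(\<lambda>m. \<phi> (?P m)) \<longlonglongrightarrow> poly S ?t"
      by (intro tendsto_eventually) (auto simp: eventually_sequentially)
    moreover have "(\<lambda>m. \<phi> (?P m)) \<longlonglongrightarrow> 0"
      using uniform_limit_exp_partial[of "cball \<mu> 1" "smult ?t x" w]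
      by (intro functional_at_closure[OF \<phi> W exp[of k]]) simp_all
    ultimately show ?thesis by (rule LIMSEQ_unique)
  qed
  then have "range (\<lambda>k::nat. - of_nat k) \<subseteq> {t. poly S t = 0}" by blast
  moreover have "infinite (range (\<lambda>k::nat. - of_nat k :: complex))"
    by (intro range_inj_infinite injI) simp
  ultimately have "S = 0"
    using poly_roots_finite finite_subset by blast
  moreover have "coeff S 1 = a 1"
    by (simp add: S_def coeff_sum del: sum.lessThan_Suc)
  ultimately show ?thesis by (simp add: a_def)
qed

section \<open>Stabilizers\<close>

lemma exp_exp_mult: "exp a * (exp b * c) = exp (a + b) * (c :: complex)"
  by (simp add: exp_add)

text \<open>Multiplication by \<open>exp q\<close> maps the closure of \<open>W\<close> into itself, and by \<open>exp (- q)\<close> as well, so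
  onto itself; its polynomials are those of \<open>W\<close>.\<close>

lemma exp_act_eq_if_stabilizer:
  assumes pd: "primary_decomposable W" and q: "q \<in> stabilizer_ring W"
  shows "exp_act q W = W"
proof
  have sub: "poly_vs.subspace W" using pd by (simp add: primary_decomposable_def)
  show "exp_act q W \<subseteq> W"
  proof
    fix w assume "w \<in> exp_act q W"
    then obtain f where "f \<in> entire_closure W" "poly w = (\<lambda>z. exp (poly q z) * f z)"
      unfolding exp_act_def by blast
    then show "w \<in> W"
      using exp_mult_in_closure[OF sub q] polynomials_in_closure[OF pd] by simp
  qed
  have "- q \<in> stabilizer_ring W"
    using q poly_vs.subspace_neg[OF sub] by (simp add: stabilizer_ring_def)
  then have "(\<lambda>z. exp (poly (- q) z) * poly w z) \<in> entire_closure W" if "w \<in> W" for w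
    using exp_mult_in_closure[OF sub] poly_in_entire_closure[OF that] by blast
  moreover have "poly w = (\<lambda>z. exp (poly q z) * (exp (poly (- q) z) * poly w z))" for w
    by (simp add: exp_exp_mult)
  ultimately show "W \<subseteq> exp_act q W"
    unfolding exp_act_def by (intro subsetI CollectI) (rule image_eqI)
qed

text \<open>Were \<open>q w\<close> outside the primary component at \<open>\<mu>\<close>, some functional at \<open>\<mu>\<close> annihilating that
  component would separate them.  Replacing \<open>q\<close> by \<open>q - q(\<mu>)\<close> changes \<open>q w\<close> by a multiple
  of \<open>w\<close> and the exponentials by constant factors, and makes \<open>functional_at_mult_eq_0\<close>
  applicable.\<close>

lemma stabilizer_if_exp_act_eq:
  assumes pd: "primary_decomposable W" and eq: "exp_act q W = W"
  shows "q \<in> stabilizer_ring W"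
proof -
  have sub: "poly_vs.subspace W" using pd by (simp add: primary_decomposable_def)
  obtain M V where MV: "\<And>\<mu>. \<mu> \<in> M \<Longrightarrow> primary_subspace \<mu> (V \<mu>)" "W = (\<Inter>\<mu>\<in>M. V \<mu>)"
    using pd unfolding primary_decomposable_def by blast
  \<comment> \<open>The inclusion \<open>W \<subseteq> exp_act q W\<close> puts \<open>exp (- q) w\<close> into the closure.\<close>
  have step: "(\<lambda>z. exp (- poly q z) * poly w z) \<in> entire_closure W" if "w \<in> W" for w
  proof -
    have "w \<in> exp_act q W" using that by (subst eq)
    then obtain f where f: "f \<in> entire_closure W" "poly w = (\<lambda>z. exp (poly q z) * f z)"
      unfolding exp_act_def by blast
    have "(\<lambda>z. exp (- poly q z) * poly w z) = f"
      by (simp add: f(2) exp_exp_mult)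
    with f(1) show ?thesis by simp
  qed
  have iterate: "(\<lambda>z. exp (- of_nat k * poly q z) * poly w z) \<in> entire_closure W" if w: "w \<in> W" for w k
  proof (induction k)
    case 0
    then show ?case using poly_in_entire_closure[OF w] by simp
  next
    case (Suc k)
    have "(\<lambda>z. exp (- poly q z) * (exp (- of_nat k * poly q z) * poly w z)) \<in> entire_closure W"
      by (rule entire_closure_mult[OF _ step Suc]) (intro holomorphic_intros)
    moreover have "exp (- poly q z) * (exp (- of_nat k * poly q z) * poly w z)
        = exp (- of_nat (Suc k) * poly q z) * poly w z" for z
      by (subst exp_exp_mult) (simp add: algebra_simps)
    ultimately show ?case by (simp only:)
  qed
  have "q * w \<in> V \<mu>" if w: "w \<in> W" and \<mu>: "\<mu> \<in> M" for w \<mu>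
  proof (rule ccontr)
    assume "q * w \<notin> V \<mu>"
    then obtain n \<phi> where \<phi>: "functional_at \<mu> n \<phi>" "\<And>v. v \<in> V \<mu> \<Longrightarrow> \<phi> v = 0" "\<phi> (q * w) = 1"
      using MV(1)[OF \<mu>] unfolding primary_subspace_def by (meson separating_functional)
    have W: "\<phi> v = 0" if "v \<in> W" for v
      using that \<mu> by (intro \<phi>(2)) (simp add: MV(2))
    define x where "x = q - [:poly q \<mu>:]"
    have "\<phi> (x * w) = 0"
    proof (rule functional_at_mult_eq_0[OF \<phi>(1)])
      show "poly x \<mu> = 0" by (simp add: x_def)
      fix k :: nat
      have "(\<lambda>z. exp (of_nat k * poly q \<mu>) * (exp (- of_nat k * poly q z) * poly w z))
          \<in> entire_closure W"
        by (rule closure_scale[OF sub iterate[OF w]])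
      moreover have "exp (of_nat k * poly q \<mu>) * (exp (- of_nat k * poly q z) * poly w z)
          = exp (- of_nat k * poly x z) * poly w z" for z
        by (subst exp_exp_mult) (simp add: x_def algebra_simps)
      ultimately show "(\<lambda>z. exp (- of_nat k * poly x z) * poly w z) \<in> entire_closure W"
        by (simp only:)
    qed (rule W)
    moreover have "x * w = q * w - smult (poly q \<mu>) w"
      by (simp add: x_def algebra_simps)
    ultimately show False
      using \<phi>(3) W[OF w] by (simp add: functional_at_simps[OF \<phi>(1)])
  qed
  then have "q * w \<in> W" if "w \<in> W" for w
    using that by (subst MV(2)) blast
  then show ?thesis
    by (simp add: stabilizer_ring_def)
qed

lemma exp_act_fixes_iff:
  assumes "primary_decomposable W"
  shows "exp_act q W = W \<longleftrightarrow> q \<in> stabilizer_ring W"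
  using assms exp_act_eq_if_stabilizer stabilizer_if_exp_act_eq by blast

lemma surj_pderiv: "surj (pderiv :: complex poly \<Rightarrow> complex poly)"
proof (rule surjI)
  fix p :: "complex poly"
  let ?q = "\<Sum>i\<le>Polynomial.degree p. monom (coeff p i / of_nat (Suc i)) (Suc i)"
  have "coeff (pderiv ?q) n = coeff p n" for n
  proof -
    have "coeff ?q (Suc n) = (if n \<le> Polynomial.degree p then coeff p n / of_nat (Suc n) else 0)"
      by (simp add: coeff_sum del: of_nat_Suc)
    then show ?thesis
      by (simp add: coeff_pderiv coeff_eq_0 del: of_nat_Suc)
  qed
  then show "pderiv ?q = p" by (rule poly_eqI)
qed

theorem proposition13:
  fixes W :: "complex poly set"
  assumes "W \<in> Gr_ad"
  shows "stab_Gy W =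
    {\<sigma> \<in> autG. \<exists>q \<in> stabilizer_ring W. \<sigma> = endo (gen_x + poly_at_y (pderiv q)) gen_y}"
proof -
  have pd: "primary_decomposable W" and sub: "poly_vs.subspace W"
    using assms by (auto simp: Gr_ad_def primary_decomposable_def)
  let ?\<sigma> = "\<lambda>q. endo (gen_x + poly_at_y (pderiv q)) gen_y"
  have "autGy = (\<lambda>p. endo (gen_x + poly_at_y p) gen_y) ` range pderiv"
    unfolding autGy_def surj_pderiv by (simp add: full_SetCompr_eq)
  then have autGy: "autGy = range ?\<sigma>"
    by (simp only: image_image)
  have act: "Gy_act (?\<sigma> q) W = W \<longleftrightarrow> q \<in> stabilizer_ring W" for q
    by (simp only: Gy_act_eq[OF sub] exp_act_fixes_iff[OF pd])
  show ?thesis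
  proof (intro equalityI subsetI)
    fix \<sigma> assume "\<sigma> \<in> stab_Gy W"
    then have \<sigma>: "\<sigma> \<in> autGy" "Gy_act \<sigma> W = W" by (simp_all add: stab_Gy_def)
    then obtain q where q: "\<sigma> = ?\<sigma> q" unfolding autGy by (elim rangeE)
    then have "q \<in> stabilizer_ring W" using \<sigma>(2) act by (simp only:)
    with q \<sigma>(1) show "\<sigma> \<in> {\<sigma> \<in> autG. \<exists>q\<in>stabilizer_ring W. \<sigma> = ?\<sigma> q}"
      using autGy_subset_autG by blast
  next
    fix \<sigma> assume "\<sigma> \<in> {\<sigma> \<in> autG. \<exists>q\<in>stabilizer_ring W. \<sigma> = ?\<sigma> q}"
    then obtain q where q: "q \<in> stabilizer_ring W" "\<sigma> = ?\<sigma> q" by blast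
    then have "\<sigma> \<in> autGy" unfolding autGy by (intro range_eqI)
    moreover have "Gy_act \<sigma> W = W" using q act by (simp only:)
    ultimately show "\<sigma> \<in> stab_Gy W" by (simp add: stab_Gy_def)
  qed
qed

end
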